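(* For any $d\in\mathbb{N}$, every $d$-representable simplicial complex is $d$-Matoušek.
   Context: Simplicial complexes are finite: a simplicial complex $K\subseteq 2^V$ on a finite vertex set $V=V(K)$ is a family of subsets (faces) of $V$ closed under taking subsets, containing $\emptyset$ and with $\{i\}\in K$ for every $i\in V$. Inclusion-maximal faces are called facets, and $\mathsf m_K$ denotes the set of facets of $K$. $\mathbb N=\{1,2,\dots\}$. $K$ is $d$-representable if there are convex sets $C_i\subseteq\mathbb{R}^d$ ($i\in V$) with $K=\{I\subseteq V:\bigcap_{i\in I}C_i\neq\emptyset\}$. Dual complex: $K'=\{\alpha\subseteq \mathsf m_K:\bigcap\alpha\neq\emptyset\}$, where $\bigcap\alpha=\bigcap_{J\in\alpha}J\subseteq V$; it is a simplicial complex with vertex set $\mathsf m_K$. Geometric realization: for a simplicial complex $L$ with vertex set $W$ and $\{e_w\}_{w\in W}$ the standard basis of $\mathbb{R}^W$, $\|F\|=\mathrm{conv}\{e_w:w\in F\}$ for $F\in L$, and $\|L\|=\bigcup_{F\in L}\|F\|$. For $x\in\|L\|$, $\mathrm{supp}(x)$ is the minimal face $F\in L$ with $x\in\|F\|$. Configuration space: $\widehat K=\{(x,y)\in\|K'\|^2:\ (\bigcap\mathrm{supp}(x))\cup(\bigcap\mathrm{supp}(y))\notin K\}$, a topological subspace of $\|K'\|^2$. $K$ is $d$-Matoušek if there exists a continuous map $f:\widehat K\to S^{d-1}$ with $f(x,y)=-f(y,x)$ for every $(x,y)\in\widehat K$. *)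

theory Defs
  imports "HOL-Analysis.Analysis" "HOL-Library.Function_Algebras"
begin

text \<open>The pointwise real vector space structure on functions. \<open>\<real>\<^sup>W\<close> is represented by functions
  of type \<open>'w \<Rightarrow> real\<close> that vanish outside \<open>W\<close>. For finite \<open>W\<close> the product topology on
  \<open>'w \<Rightarrow> real\<close> restricts to the Euclidean topology on this subspace.\<close>

instantiation "fun" :: (type, real_vector) real_vector
begin

definition scaleR_fun :: "real \<Rightarrow> ('a \<Rightarrow> 'b) \<Rightarrow> 'a \<Rightarrow> 'b"
  where "scaleR_fun c f = (\<lambda>x. c *\<^sub>R f x)"

instance
  by standard (simp_all add: scaleR_fun_def fun_eq_iff scaleR_add_right scaleR_add_left)

end

definition abstract_complex :: "'v set \<Rightarrow> 'v set set \<Rightarrow> bool"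
  where "abstract_complex V K \<longleftrightarrow>
    finite V \<and> K \<subseteq> Pow V \<and> {} \<in> K \<and> (\<forall>i\<in>V. {i} \<in> K) \<and> (\<forall>I\<in>K. \<forall>J\<subseteq>I. J \<in> K)"

definition facets :: "'v set set \<Rightarrow> 'v set set"
  where "facets K = {J \<in> K. \<forall>I\<in>K. J \<subseteq> I \<longrightarrow> I = J}"

text \<open>The type argument fixes the dimension \<open>d = CARD('d)\<close>. The empty intersection is the whole
  space.\<close>

definition representable :: "'d::finite itself \<Rightarrow> 'v set \<Rightarrow> 'v set set \<Rightarrow> bool"
  where "representable (_ :: 'd itself) V K \<longleftrightarrow>
    (\<exists>C :: 'v \<Rightarrow> (real ^ 'd) set.
      (\<forall>i\<in>V. convex (C i)) \<and> K = {I. I \<subseteq> V \<and> (\<Inter>i\<in>I. C i) \<noteq> {}})"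

text \<open>The intersection of a family of faces, formed inside \<open>V\<close>; in particular it is \<open>V\<close> for the
  empty family.\<close>

definition face_Inter :: "'v set \<Rightarrow> 'v set set \<Rightarrow> 'v set"
  where "face_Inter V \<alpha> = V \<inter> \<Inter> \<alpha>"

definition dual_complex :: "'v set \<Rightarrow> 'v set set \<Rightarrow> 'v set set set"
  where "dual_complex V K = {\<alpha>. \<alpha> \<subseteq> facets K \<and> face_Inter V \<alpha> \<noteq> {}}"

definition std_basis :: "'w \<Rightarrow> 'w \<Rightarrow> real"
  where "std_basis w = (\<lambda>u. if u = w then 1 else 0)"

definition geom_simplex :: "'w set \<Rightarrow> ('w \<Rightarrow> real) set"
  where "geom_simplex F = convex hull (std_basis ` F)"

definition geom_realization :: "'w set set \<Rightarrow> ('w \<Rightarrow> real) set"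
  where "geom_realization L = (\<Union>F\<in>L. geom_simplex F)"

definition supp :: "'w set set \<Rightarrow> ('w \<Rightarrow> real) \<Rightarrow> 'w set"
  where "supp L x =
    (THE F. F \<in> L \<and> x \<in> geom_simplex F \<and> (\<forall>G\<in>L. x \<in> geom_simplex G \<and> G \<subseteq> F \<longrightarrow> G = F))"

definition config_space :: "'v set \<Rightarrow> 'v set set \<Rightarrow> (('v set \<Rightarrow> real) \<times> ('v set \<Rightarrow> real)) set"
  where "config_space V K =
    {(x, y). x \<in> geom_realization (dual_complex V K) \<and> y \<in> geom_realization (dual_complex V K) \<and>
      face_Inter V (supp (dual_complex V K) x) \<union> face_Inter V (supp (dual_complex V K) y) \<notin> K}"

text \<open>Again \<open>d = CARD('d)\<close>, and \<open>S\<^sup>d\<^sup>-\<^sup>1\<close> is the unit sphere of \<open>real ^ 'd\<close>.\<close>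

definition matousek :: "'d::finite itself \<Rightarrow> 'v set \<Rightarrow> 'v set set \<Rightarrow> bool"
  where "matousek (_ :: 'd itself) V K \<longleftrightarrow>
    (\<exists>f :: ('v set \<Rightarrow> real) \<times> ('v set \<Rightarrow> real) \<Rightarrow> real ^ 'd.
      continuous_on (config_space V K) f \<and>
      f ` config_space V K \<subseteq> sphere 0 1 \<and>
      (\<forall>(x, y)\<in>config_space V K. f (x, y) = - f (y, x)))"

end

theory Submission
  imports Defs
begin

text \<open>Choose a point \<open>p J\<close> in \<open>\<Inter>i\<in>J. C i\<close> for every facet \<open>J\<close> and extend linearly to
  \<open>F x = (\<Sum>J. x J *\<^sub>R p J)\<close>. Since \<open>F x\<close> is a convex combination of the points \<open>p J\<close> with \<open>J\<close> in the
  support of \<open>x\<close>, it lies in \<open>C i\<close> for every \<open>i\<close> common to all these facets. Hence \<open>F x = F y\<close> would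
  be a point of \<open>C i\<close> for all \<open>i\<close> in the union of the two intersections, which is impossible on the
  configuration space. So \<open>(F x - F y) / \<parallel>F x - F y\<parallel>\<close> is defined there and antisymmetric.\<close>

lemma sum_fun_apply: "sum f A x = (\<Sum>a\<in>A. f a x)"
  by (induction A rule: infinite_finite_induct) (auto simp: zero_fun_def)

text \<open>These are barycentric coordinates: the conditions cut out a convex set containing the
  vertices, and conversely such an \<open>x\<close> is the convex combination of the basis vectors
  weighted by its own coordinates.\<close>

lemma mem_geom_simplex_iff:
  assumes "finite G"
  shows "x \<in> geom_simplex G \<longleftrightarrow>
    (\<forall>w. 0 \<le> x w) \<and> (\<forall>w. w \<notin> G \<longrightarrow> x w = 0) \<and> sum x G = 1" (is "_ \<longleftrightarrow> ?P x")
proof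
  have "convex {x. ?P x}"
    unfolding convex_def
    by (auto simp: scaleR_fun_def sum.distrib simp flip: sum_distrib_left)
  moreover have "std_basis ` G \<subseteq> {x. ?P x}"
    using assms by (auto simp: std_basis_def split: if_splits)
  ultimately have "geom_simplex G \<subseteq> {x. ?P x}"
    unfolding geom_simplex_def by (rule hull_minimal[rotated])
  then show "x \<in> geom_simplex G \<Longrightarrow> ?P x"
    by auto
next
  assume x: "?P x"
  have "(\<Sum>w\<in>G. x w *\<^sub>R std_basis w) \<in> convex hull (std_basis ` G)"
    using assms x by (intro convex_sum) (auto intro: hull_inc)
  moreover have "(\<Sum>w\<in>G. x w *\<^sub>R std_basis w) = x"
    using assms x by (auto simp: fun_eq_iff sum_fun_apply scaleR_fun_def std_basis_def if_distrib cong: if_cong)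
  ultimately show "x \<in> geom_simplex G"
    by (simp add: geom_simplex_def)
qed

text \<open>A face whose simplex contains \<open>x\<close> must contain every vertex with nonzero
  coordinate, so these vertices form the least such face; this resolves the \<open>THE\<close> in
  \<open>supp\<close>.\<close>

lemma supp_eq:
  assumes fin: "\<And>F. F \<in> L \<Longrightarrow> finite F"
    and down: "\<And>F G. F \<in> L \<Longrightarrow> G \<subseteq> F \<Longrightarrow> G \<in> L"
    and x: "x \<in> geom_realization L"
  shows "supp L x = {w. x w \<noteq> 0}" "supp L x \<in> L" "x \<in> geom_simplex (supp L x)"
proof -
  let ?S = "{w. x w \<noteq> 0}"
  obtain F where F: "F \<in> L" "x \<in> geom_simplex F"
    using x by (auto simp: geom_realization_def)
  have sub: "?S \<subseteq> G" "x \<in> geom_simplex ?S" if "G \<in> L" "x \<in> geom_simplex G" for G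
  proof -
    have G: "\<forall>w. 0 \<le> x w" "\<forall>w. w \<notin> G \<longrightarrow> x w = 0" "sum x G = 1"
      using that fin[of G] by (simp_all add: mem_geom_simplex_iff)
    then show "?S \<subseteq> G" by blast
    have "sum x ?S = sum x G"
      using G fin[OF that(1)] by (intro sum.mono_neutral_left) auto
    then show "x \<in> geom_simplex ?S"
      using G fin[OF that(1)] by (subst mem_geom_simplex_iff) (auto intro: finite_subset)
  qed
  have S: "?S \<in> L" "x \<in> geom_simplex ?S"
    using sub[OF F] down[OF F(1)] by auto
  show eq: "supp L x = ?S"
    unfolding supp_def using S sub by (intro the_equality) blast+
  show "supp L x \<in> L" "x \<in> geom_simplex (supp L x)"
    unfolding eq by (fact S)+
qed

theorem proposition3p7:
  fixes V :: "'v set" and K :: "'v set set"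
  assumes "abstract_complex V K"
    and "representable TYPE('d::finite) V K"
  shows "matousek TYPE('d) V K"
proof -
  obtain C :: "'v \<Rightarrow> (real ^ 'd) set" where conv: "\<And>i. i \<in> V \<Longrightarrow> convex (C i)"
    and K: "K = {I. I \<subseteq> V \<and> (\<Inter>i\<in>I. C i) \<noteq> {}}"
    using assms(2) by (auto simp: representable_def)
  let ?L = "dual_complex V K"
  have "finite K"
    using assms(1) unfolding abstract_complex_def by (meson finite_Pow_iff finite_subset)
  then have fin: "finite (facets K)"
    by (simp add: facets_def)
  have finL: "finite \<alpha>" if "\<alpha> \<in> ?L" for \<alpha>
    using that fin by (auto simp: dual_complex_def intro: finite_subset)
  have down: "\<beta> \<in> ?L" if "\<alpha> \<in> ?L" "\<beta> \<subseteq> \<alpha>" for \<alpha> \<beta>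
    using that by (fastforce simp: dual_complex_def face_Inter_def)
  have "\<exists>z. z \<in> (\<Inter>i\<in>J. C i)" if "J \<in> facets K" for J
    using that K by (auto simp: facets_def)
  then obtain p where p: "\<And>J i. J \<in> facets K \<Longrightarrow> i \<in> J \<Longrightarrow> p J \<in> C i"
    by (metis INT_iff)
  define F where "F x = (\<Sum>J\<in>facets K. x J *\<^sub>R p J)" for x :: "'v set \<Rightarrow> real"
  have F_mem: "F x \<in> C i" if x: "x \<in> geom_realization ?L" and i: "i \<in> face_Inter V (supp ?L x)" for x i
  proof -
    note s = supp_eq[OF finL down x, simplified]
    let ?A = "supp ?L x"
    have A: "?A \<subseteq> facets K" "finite ?A"
      using s(2) finL by (auto simp: dual_complex_def)
    \<comment> \<open>After the zero terms are dropped, only facets containing \<open>i\<close>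
      remain, so every \<open>p J\<close> left in the sum lies in \<open>C i\<close>.\<close>
    have "F x = (\<Sum>J\<in>?A. x J *\<^sub>R p J)"
      unfolding F_def using A fin s(1) by (intro sum.mono_neutral_right) auto
    also have "\<dots> \<in> C i"
      using A s(3) i p conv by (intro convex_sum) (auto simp: mem_geom_simplex_iff face_Inter_def)
    finally show ?thesis .
  qed
  have ne: "F x \<noteq> F y" if "(x, y) \<in> config_space V K" for x y
  proof
    assume eq: "F x = F y"
    let ?I = "face_Inter V (supp ?L x) \<union> face_Inter V (supp ?L y)"
    have "F x \<in> (\<Inter>i\<in>?I. C i)"
      using that F_mem[of x] F_mem[of y] eq by (auto simp: config_space_def)
    moreover have "?I \<subseteq> V"
      by (auto simp: face_Inter_def)
    ultimately have "?I \<in> K"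
      unfolding K by blast
    then show False
      using that by (simp add: config_space_def)
  qed
  \<comment> \<open>In the product topology each coordinate \<open>x J\<close> is continuous, and
    \<open>F\<close> is a finite linear combination of these.\<close>
  have contF: "continuous_on UNIV F"
    unfolding F_def by (intro continuous_intros continuous_on_product_coordinates)
  \<comment> \<open>On vectors, \<open>sgn\<close> is normalization, with value 0 at 0; it is odd,
    and \<open>ne\<close> keeps its argument away from 0.\<close>
  define f where "f = (\<lambda>(x, y). sgn (F x - F y))"
  have "continuous_on (config_space V K) (\<lambda>z. sgn (F (fst z) - F (snd z)))"
    using ne by (intro continuous_on_sgn continuous_on_diff
        continuous_on_compose2[OF contF] continuous_on_fst continuous_on_snd continuous_on_id) auto
  then have "continuous_on (config_space V K) f"
    by (simp add: f_def case_prod_unfold)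
  moreover have "f ` config_space V K \<subseteq> sphere 0 1"
    using ne by (auto simp: f_def norm_sgn)
  moreover have "\<forall>(x, y)\<in>config_space V K. f (x, y) = - f (y, x)"
    by (auto simp: f_def simp flip: sgn_minus)
  ultimately show ?thesis
    unfolding matousek_def by blast
qed

end
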